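(* For $n\ge1$, the number of separable permutations of length $n$ with exactly three occurrences of the 1-box pattern equals the number of separable permutations of length $n-1$ with exactly two occurrences of the 1-box pattern.
   Context: A permutation is separable if it avoids both patterns $2413$ and $3142$, i.e., it has no subsequence of four entries order-isomorphic to $2413$ or to $3142$. For a permutation $\sigma=\sigma_1\cdots\sigma_n$, the number of occurrences of the 1-box pattern is the number of indices $i\in\{1,\dots,n\}$ such that $|\sigma_i-\sigma_{i+1}|=1$ or $|\sigma_{i-1}-\sigma_i|=1$ (conditions involving nonexistent entries $\sigma_0,\sigma_{n+1}$ are ignored). *)

theory Defs
  imports "HOL-Library.Sublist" "HOL-Combinatorics.Multiset_Permutations"
begin

text \<open>
  A permutation of length \<open>n\<close> is given in one-line notation, as a list in
  \<open>permutations_of_set {1..n}\<close>, i.e. a list containing each of \<open>1, \<dots>, n\<close> exactly once.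
\<close>

definition order_iso :: "nat list \<Rightarrow> nat list \<Rightarrow> bool" where
  "order_iso xs ys \<longleftrightarrow>
     length xs = length ys \<and>
     (\<forall>i < length xs. \<forall>j < length xs. xs ! i < xs ! j \<longleftrightarrow> ys ! i < ys ! j)"

definition avoids :: "nat list \<Rightarrow> nat list \<Rightarrow> bool" where
  "avoids \<sigma> p \<longleftrightarrow> \<not> (\<exists>xs. subseq xs \<sigma> \<and> order_iso xs p)"

definition separable :: "nat list \<Rightarrow> bool" where
  "separable \<sigma> \<longleftrightarrow> avoids \<sigma> [2, 4, 1, 3] \<and> avoids \<sigma> [3, 1, 4, 2]"

text \<open>
  List positions count from 0, so position \<open>i\<close> holds the entry usually written
  \<open>\<sigma>\<close> with index \<open>i + 1\<close>. Differences are taken in \<open>int\<close> since subtraction on \<open>nat\<close> truncates.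
\<close>

definition one_box_occurrences :: "nat list \<Rightarrow> nat" where
  "one_box_occurrences \<sigma> =
     card {i. i < length \<sigma> \<and>
       (Suc i < length \<sigma> \<and> \<bar>int (\<sigma> ! i) - int (\<sigma> ! Suc i)\<bar> = 1 \<or>
        0 < i \<and> \<bar>int (\<sigma> ! (i - 1)) - int (\<sigma> ! i)\<bar> = 1)}"

definition separable_with_one_box :: "nat \<Rightarrow> nat \<Rightarrow> nat list set" where
  "separable_with_one_box n k =
     {\<sigma> \<in> permutations_of_set {1..n}. separable \<sigma> \<and> one_box_occurrences \<sigma> = k}"

end

theory Submission imports Defs begin

text \<open>
  Say that two adjacent entries form a bond if their values differ by 1. A permutation has two
  occurrences of the 1-box pattern iff it has exactly one bond, and three iff it has exactly two
  bonds and these overlap, i.e. iff the occurrences form a single monotone run of three consecutive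
  values. Stretching the run \<open>a, a + 1\<close> of the former to \<open>a, a + 1, a + 2\<close> (and similarly for
  decreasing runs) is a bijection onto the latter. It respects separability because neither 2413
  nor 3142 has a bond, so an occurrence of such a pattern uses at most one end of a bond, and the
  two ends are then interchangeable.
\<close>

section \<open>Bonds and the number of one-box occurrences\<close>

text \<open>A bond is recorded by its left position. Using \<open>Suc\<close> on both sides replaces
  the integer differences, so that no subtraction has to be handled later.\<close>

definition bonds :: "nat list \<Rightarrow> nat set" where
  "bonds \<sigma> = {i. Suc i < length \<sigma> \<and> (\<sigma> ! i = Suc (\<sigma> ! Suc i) \<or> \<sigma> ! Suc i = Suc (\<sigma> ! i))}"

lemma finite_bonds: "finite (bonds \<sigma>)"
  by (rule finite_subset[of _ "{..<length \<sigma>}"]) (auto simp: bonds_def)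

text \<open>A position is an occurrence iff it is the left or the right end of some bond, and the
  right end is one step after the left.\<close>

lemma one_box_occurrences_eq: "one_box_occurrences \<sigma> = card (bonds \<sigma> \<union> Suc ` bonds \<sigma>)"
proof -
  have diff: "\<bar>int a - int b\<bar> = 1 \<longleftrightarrow> a = Suc b \<or> b = Suc a" for a b
    by linarith
  have "{i. i < length \<sigma> \<and> (Suc i < length \<sigma> \<and> \<bar>int (\<sigma> ! i) - int (\<sigma> ! Suc i)\<bar> = 1 \<or>
        0 < i \<and> \<bar>int (\<sigma> ! (i - 1)) - int (\<sigma> ! i)\<bar> = 1)} = bonds \<sigma> \<union> Suc ` bonds \<sigma>"
    unfolding diff bonds_def by (auto simp: image_iff gr0_conv_Suc)
  then show ?thesis
    by (simp add: one_box_occurrences_def)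
qed

text \<open>The successor of the maximum is always a new element. This bounds the number of bonds by
  the number of occurrences minus one.\<close>

lemma card_less_card_Un_Suc:
  fixes B :: "nat set"
  assumes "finite B" "B \<noteq> {}"
  shows "card B < card (B \<union> Suc ` B)"
proof -
  have "Suc (Max B) \<notin> B"
    using assms Max_ge Suc_n_not_le_n by blast
  then have "B \<subset> B \<union> Suc ` B"
    using Max_in[OF assms] by blast
  then show ?thesis
    using assms by (intro psubset_card_mono) auto
qed

lemma card_Un_Suc_eq_2_iff:
  fixes B :: "nat set"
  assumes "finite B"
  shows "card (B \<union> Suc ` B) = 2 \<longleftrightarrow> (\<exists>i. B = {i})"
proof
  assume two: "card (B \<union> Suc ` B) = 2"
  then have "B \<noteq> {}"
    by auto
  with two assms have "card B = 1"
    using card_less_card_Un_Suc[of B] by (simp add: le_Suc_eq less_Suc_eq numeral_2_eq_2)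
  then show "\<exists>i. B = {i}"
    by (rule card_1_singletonE) blast
qed auto

lemma card_Un_Suc_eq_3_iff:
  fixes B :: "nat set"
  assumes "finite B"
  shows "card (B \<union> Suc ` B) = 3 \<longleftrightarrow> (\<exists>i. B = {i, Suc i})"
proof
  assume three: "card (B \<union> Suc ` B) = 3"
  then have nonempty: "B \<noteq> {}"
    by auto
  have "\<nexists>i. B = {i}"
    using three card_Un_Suc_eq_2_iff[OF assms] by simp
  then have "card B \<noteq> 1"
    by (metis card_1_singletonE)
  moreover have "card B \<noteq> 0"
    using nonempty assms by simp
  moreover have "card B < 3"
    using card_less_card_Un_Suc[OF assms nonempty] three by simp
  ultimately have "card B = 2"
    by linarith
  then obtain a b where ab: "B = {a, b}" "a \<noteq> b"
    by (meson card_2_iff)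
  show "\<exists>i. B = {i, Suc i}"
  proof (rule ccontr)
    assume no: "\<nexists>i. B = {i, Suc i}"
    then have "b \<noteq> Suc a" "a \<noteq> Suc b"
      using ab by (auto simp: insert_commute)
    \<comment> \<open>Two non-overlapping bonds cover the four distinct positions \<open>a\<close>,
      \<open>Suc a\<close>, \<open>b\<close>, \<open>Suc b\<close>.\<close>
    then have "card (B \<union> Suc ` B) = 4"
      using ab by (auto simp: card_insert_if)
    then show False
      using three by simp
  qed
qed (auto simp: card_insert_if)

section \<open>Pattern avoidance under relabelling and under shortening a bond\<close>

text \<open>The same index sets select the subsequences of both lists, and a strictly monotone map
  leaves the relative order of the selected entries alone.\<close>

lemma avoids_map_strict_mono:
  assumes "strict_mono f"
  shows "avoids (map f \<sigma>) p \<longleftrightarrow> avoids \<sigma> p"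
proof -
  have iso: "order_iso (map f xs) p \<longleftrightarrow> order_iso xs p" for xs
    using strict_mono_less[OF assms] by (auto simp: order_iso_def)
  have sub: "subseq xs (map f \<sigma>) \<longleftrightarrow> (\<exists>ys. subseq ys \<sigma> \<and> xs = map f ys)" for xs
    by (auto simp: subseq_conv_nths nths_map)
  show ?thesis
    unfolding avoids_def sub using iso by auto
qed

text \<open>The assumption \<open>no_bond\<close> says that between any two neighbouring entries of
  \<open>p\<close> some entry of \<open>p\<close> lies strictly in value. Hence an occurrence of
  \<open>p\<close> cannot use both \<open>u\<close> and \<open>m\<close>, which are neighbours with
  no value between them. One that omits \<open>m\<close> survives its deletion, and one that omits
  \<open>u\<close> can use \<open>u\<close> in place of \<open>m\<close>.\<close>

lemma avoids_remove_bond: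
  assumes dist: "distinct (A @ u # m # B)"
    and bond: "u = Suc m \<or> m = Suc u"
    and no_bond: "\<And>k. Suc k < length p \<Longrightarrow>
      \<exists>j<length p. p ! k < p ! j \<and> p ! j < p ! Suc k \<or> p ! Suc k < p ! j \<and> p ! j < p ! k"
  shows "avoids (A @ u # m # B) p \<longleftrightarrow> avoids (A @ u # B) p"
proof -
  have "\<exists>xs'. subseq xs' (A @ u # B) \<and> order_iso xs' p"
    if sub: "subseq xs (A @ u # m # B)" and iso: "order_iso xs p" for xs
  proof -
    consider "m \<notin> set xs" | "u \<notin> set xs" | "u \<in> set xs" "m \<in> set xs"
      by blast
    then show ?thesis
    proof cases
      case 1
      \<comment> \<open>Filtering out \<open>m\<close> fixes \<open>xs\<close> and, by distinctness,
        deletes exactly one entry of the long list; \<open>subseq\<close> is preserved by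
        filtering.\<close>
      then have "filter (\<lambda>x. x \<noteq> m) xs = xs"
        by (auto simp: filter_id_conv)
      moreover have "filter (\<lambda>x. x \<noteq> m) A = A" "filter (\<lambda>x. x \<noteq> m) B = B"
        using dist by (auto intro!: filter_True)
      then have "filter (\<lambda>x. x \<noteq> m) (A @ u # m # B) = A @ u # B"
        using dist by auto
      ultimately have "subseq xs (A @ u # B)"
        using subseq_filter[OF sub, of "\<lambda>x. x \<noteq> m"] by simp
      then show ?thesis
        using iso by blast
    next
      case 2
      define f where "f = (\<lambda>x. if x = m then u else x)"
      have "filter (\<lambda>x. x \<noteq> u) xs = xs"
        using 2 by (auto simp: filter_id_conv)
      moreover have "filter (\<lambda>x. x \<noteq> u) A = A" "filter (\<lambda>x. x \<noteq> u) B = B"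
        using dist by (auto intro!: filter_True)
      then have "filter (\<lambda>x. x \<noteq> u) (A @ u # m # B) = A @ m # B"
        using dist by auto
      ultimately have "subseq xs (A @ m # B)"
        using subseq_filter[OF sub, of "\<lambda>x. x \<noteq> u"] by simp
      then have "subseq (map f xs) (map f (A @ m # B))"
        by (rule subseq_map)
      also have "map f (A @ m # B) = A @ u # B"
        using dist by (auto simp: f_def intro!: map_idI)
      finally have "subseq (map f xs) (A @ u # B)" .
      \<comment> \<open>Away from \<open>u\<close>, moving the value \<open>m\<close> to
        \<open>u\<close> crosses no other value, because the two differ by 1.\<close>
      moreover have "f x < f y \<longleftrightarrow> x < y" if "x \<in> set xs" "y \<in> set xs" for x y
      proof -
        have "x \<noteq> u" "y \<noteq> u"
          using 2 that by auto
        then show ?thesis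
          using bond unfolding f_def by auto
      qed
      then have "order_iso (map f xs) p"
        using iso by (auto simp: order_iso_def)
      ultimately show ?thesis
        by blast
    next
      case 3
      \<comment> \<open>Distinctness forces the embedding to match \<open>u\<close> and
        \<open>m\<close> with themselves, so they stand next to each other in \<open>xs\<close> too,
        at \<open>k\<close> and \<open>Suc k\<close>.\<close>
      obtain xs1 xs2 where xs: "xs = xs1 @ xs2" "subseq xs1 A" "subseq xs2 (u # m # B)"
        using sub by (auto simp: subseq_append_iff)
      have "u \<notin> set xs1" "m \<notin> set xs1"
        using list_emb_set[OF xs(2)] dist by auto
      then have in2: "u \<in> set xs2" "m \<in> set xs2"
        using 3 xs(1) by auto
      from xs(3) obtain xs3 where xs3: "xs2 = u # xs3" "subseq xs3 (m # B)"
        using in2 dist list_emb_set[of "(=)" xs2 "m # B" u]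
        by (cases rule: list_emb.cases) auto
      have "m \<in> set xs3"
        using in2 xs3 dist by auto
      with xs3(2) obtain xs4 where xs4: "xs3 = m # xs4"
        using dist list_emb_set[of "(=)" xs3 B m]
        by (cases rule: list_emb.cases) auto
      define k where "k = length xs1"
      have k: "Suc k < length xs" "xs ! k = u" "xs ! Suc k = m"
        by (auto simp: k_def xs(1) xs3(1) xs4 nth_append)
      have less: "xs ! i < xs ! j \<longleftrightarrow> p ! i < p ! j" if "i < length p" "j < length p" for i j
        using iso that by (auto simp: order_iso_def)
      have len: "length xs = length p"
        using iso by (simp add: order_iso_def)
      obtain j where j: "j < length p"
        "p ! k < p ! j \<and> p ! j < p ! Suc k \<or> p ! Suc k < p ! j \<and> p ! j < p ! k"
        using no_bond[of k] k(1) len by auto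
      then have "u < xs ! j \<and> xs ! j < m \<or> m < xs ! j \<and> xs ! j < u"
        using less k len by (metis Suc_lessD)
      then show ?thesis
        using bond by linarith
    qed
  qed
  moreover have "subseq (A @ u # B) (A @ u # m # B)"
    by (intro list_emb_append_mono) auto
  ultimately show ?thesis
    unfolding avoids_def using subseq_order.trans by blast
qed

lemma separable_map_strict_mono:
  "strict_mono f \<Longrightarrow> separable (map f \<sigma>) \<longleftrightarrow> separable \<sigma>"
  by (simp add: separable_def avoids_map_strict_mono)

text \<open>Values lying between neighbours: in 2413 they are 3 for 2,4, then 2 or 3 for 4,1, then 2
  for 1,3; in 3142 they are 2 for 3,1, then 2 or 3 for 1,4, then 3 for 4,2.\<close>

lemma separable_remove_bond:
  assumes "distinct (A @ u # m # B)" "u = Suc m \<or> m = Suc u"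
  shows "separable (A @ u # m # B) \<longleftrightarrow> separable (A @ u # B)"
proof -
  have lt3: "k = 0 \<or> k = 1 \<or> k = 2" if "Suc k < 4" for k
    using that by linarith
  have "avoids (A @ u # m # B) [2, 4, 1, 3] \<longleftrightarrow> avoids (A @ u # B) [2, 4, 1, 3]"
  proof (rule avoids_remove_bond[OF assms])
    fix k assume "Suc k < length [2, 4, 1, 3 :: nat]"
    then have "k = 0 \<or> k = 1 \<or> k = 2"
      using lt3 by simp
    then show "\<exists>j<length [2, 4, 1, 3 :: nat].
        [2, 4, 1, 3 :: nat] ! k < [2, 4, 1, 3] ! j \<and> [2, 4, 1, 3 :: nat] ! j < [2, 4, 1, 3] ! Suc k \<or>
        [2, 4, 1, 3 :: nat] ! Suc k < [2, 4, 1, 3] ! j \<and> [2, 4, 1, 3 :: nat] ! j < [2, 4, 1, 3] ! k"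
      by (elim disjE) (auto simp: Ex_less_Suc2 numeral_nat)
  qed
  moreover have "avoids (A @ u # m # B) [3, 1, 4, 2] \<longleftrightarrow> avoids (A @ u # B) [3, 1, 4, 2]"
  proof (rule avoids_remove_bond[OF assms])
    fix k assume "Suc k < length [3, 1, 4, 2 :: nat]"
    then have "k = 0 \<or> k = 1 \<or> k = 2"
      using lt3 by simp
    then show "\<exists>j<length [3, 1, 4, 2 :: nat].
        [3, 1, 4, 2 :: nat] ! k < [3, 1, 4, 2] ! j \<and> [3, 1, 4, 2 :: nat] ! j < [3, 1, 4, 2] ! Suc k \<or>
        [3, 1, 4, 2 :: nat] ! Suc k < [3, 1, 4, 2] ! j \<and> [3, 1, 4, 2 :: nat] ! j < [3, 1, 4, 2] ! k"
      by (elim disjE) (auto simp: Ex_less_Suc2 numeral_nat)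
  qed
  ultimately show ?thesis
    by (simp add: separable_def)
qed

section \<open>Opening a gap in the values\<close>

text \<open>The increasing bijection from the naturals onto the naturals other than
  \<open>m\<close>.\<close>

definition shift :: "nat \<Rightarrow> nat \<Rightarrow> nat" where
  "shift m x = (if m \<le> x then Suc x else x)"

lemma strict_mono_shift: "strict_mono (shift m)"
  by (auto simp: strict_mono_def shift_def)

lemma inj_shift: "inj (shift m)"
  by (rule strict_mono_imp_inj_on[OF strict_mono_shift])

lemma shift_neq: "shift m x \<noteq> m"
  by (auto simp: shift_def)

text \<open>The shifted interval misses just \<open>m\<close>, provided the gap lies inside the
  longer interval. For \<open>m = Suc N\<close> nothing moves and the gap is at the top.\<close>

lemma shift_image_interval:
  assumes "1 \<le> m" "m \<le> Suc N"
  shows "insert m (shift m ` {1..N}) = {1..Suc N}"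
proof
  show "{1..Suc N} \<subseteq> insert m (shift m ` {1..N})"
  proof
    fix x assume x: "x \<in> {1..Suc N}"
    consider "x = m" | "x < m" | "m < x"
      by linarith
    then show "x \<in> insert m (shift m ` {1..N})"
    proof cases
      case 2
      then have "x = shift m x" "x \<in> {1..N}"
        using x assms by (auto simp: shift_def)
      then show ?thesis
        by blast
    next
      case 3
      then have "x = shift m (x - 1)" "x - 1 \<in> {1..N}"
        using x assms by (auto simp: shift_def)
      then show ?thesis
        by blast
    qed simp
  qed
qed (use assms in \<open>auto simp: shift_def\<close>)

section \<open>Stretching a bond to a run of three\<close>

text \<open>Taking the larger end as the new middle value serves both directions:
  \<open>a, a + 1\<close> becomes \<open>a, a + 1, a + 2\<close>, and \<open>a + 1, a\<close>
  becomes \<open>a + 2, a + 1, a\<close>.\<close>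

definition stretch :: "nat \<Rightarrow> nat list \<Rightarrow> nat list" where
  "stretch i \<sigma> = (let m = max (\<sigma> ! i) (\<sigma> ! Suc i)
     in map (shift m) (take (Suc i) \<sigma>) @ m # map (shift m) (drop (Suc i) \<sigma>))"

lemma stretch_append:
  "stretch (length A) (A @ u # v # B) =
     map (shift (max u v)) (A @ [u]) @ max u v # map (shift (max u v)) (v # B)"
  by (simp add: stretch_def nth_append Let_def)

lemma bondE:
  assumes "i \<in> bonds \<sigma>"
  obtains A u v B where "\<sigma> = A @ u # v # B" "i = length A" "u = Suc v \<or> v = Suc u"
proof
  have i: "Suc i < length \<sigma>"
    using assms by (simp add: bonds_def)
  then show "\<sigma> = take i \<sigma> @ \<sigma> ! i # \<sigma> ! Suc i # drop (Suc (Suc i)) \<sigma>"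
    by (simp add: Cons_nth_drop_Suc)
  show "i = length (take i \<sigma>)"
    using i by simp
  show "\<sigma> ! i = Suc (\<sigma> ! Suc i) \<or> \<sigma> ! Suc i = Suc (\<sigma> ! i)"
    using assms by (simp add: bonds_def)
qed

text \<open>The inserted value is outside the range of \<open>shift\<close>, and
  \<open>shift\<close> is injective, so repetitions are neither created nor lost.\<close>

lemma distinct_stretch_iff: "distinct (stretch i \<sigma>) \<longleftrightarrow> distinct \<sigma>"
proof -
  have "distinct (stretch i \<sigma>) \<longleftrightarrow> distinct (map (shift (max (\<sigma> ! i) (\<sigma> ! Suc i))) (take (Suc i) \<sigma> @ drop (Suc i) \<sigma>))"
    unfolding stretch_def Let_def map_append
    by (auto simp: shift_neq shift_neq[symmetric] simp del: append_take_drop_id)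
  also have "\<dots> \<longleftrightarrow> distinct \<sigma>"
    by (simp add: distinct_map inj_on_subset[OF inj_shift])
  finally show ?thesis .
qed

lemma set_stretch:
  "set (stretch i \<sigma>) = insert (max (\<sigma> ! i) (\<sigma> ! Suc i)) (shift (max (\<sigma> ! i) (\<sigma> ! Suc i)) ` set \<sigma>)"
proof -
  have "set \<sigma> = set (take (Suc i) \<sigma>) \<union> set (drop (Suc i) \<sigma>)"
    by (metis append_take_drop_id set_append)
  then show ?thesis
    by (auto simp: stretch_def Let_def)
qed

text \<open>The inserted entry forms a bond with its left neighbour. Deleting it leaves
  \<open>map ?s \<sigma>\<close>, an increasing relabelling of \<open>\<sigma>\<close>.\<close>

lemma separable_stretch_iff:
  assumes "distinct \<sigma>" "i \<in> bonds \<sigma>"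
  shows "separable (stretch i \<sigma>) \<longleftrightarrow> separable \<sigma>"
proof -
  from assms(2) obtain A u v B where \<sigma>: "\<sigma> = A @ u # v # B" "i = length A" "u = Suc v \<or> v = Suc u"
    by (rule bondE)
  let ?s = "shift (max u v)"
  have st: "stretch i \<sigma> = map ?s A @ ?s u # max u v # map ?s (v # B)"
    using stretch_append[of A u v B] \<sigma> by simp
  have "?s u = Suc (max u v) \<or> max u v = Suc (?s u)"
    using \<sigma>(3) by (auto simp: shift_def)
  moreover have "distinct (map ?s A @ ?s u # max u v # map ?s (v # B))"
    using distinct_stretch_iff[of i \<sigma>] assms(1) unfolding st by simp
  ultimately have "separable (stretch i \<sigma>) \<longleftrightarrow> separable (map ?s A @ ?s u # map ?s (v # B))"
    unfolding st by (intro separable_remove_bond)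
  also have "map ?s A @ ?s u # map ?s (v # B) = map ?s \<sigma>"
    using \<sigma>(1) by simp
  finally show ?thesis
    by (simp add: separable_map_strict_mono[OF strict_mono_shift])
qed

text \<open>The stretched list is one entry longer, so \<open>j = length \<sigma>\<close> is its
  last position. Positions after the inserted one read \<open>\<sigma>\<close> one place
  earlier.\<close>

lemma nth_stretch:
  assumes "Suc i < length \<sigma>" "j \<le> length \<sigma>"
  shows "stretch i \<sigma> ! j = (let m = max (\<sigma> ! i) (\<sigma> ! Suc i)
    in if j \<le> i then shift m (\<sigma> ! j) else if j = Suc i then m else shift m (\<sigma> ! (j - 1)))"
proof -
  consider "j \<le> i" | "j = Suc i" | "Suc i < j"
    by linarith
  then show ?thesis
  proof cases
    case 3
    then obtain d where "j = Suc (Suc i + d)"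
      using less_imp_Suc_add by blast
    then show ?thesis
      using assms 3 by (simp add: stretch_def Let_def nth_append)
  qed (use assms in \<open>auto simp: stretch_def Let_def nth_append\<close>)
qed

lemma length_stretch: "length (stretch i \<sigma>) = Suc (length \<sigma>)"
  by (simp add: stretch_def Let_def)

text \<open>A distance grows, by one, only if one value is below \<open>m\<close> and the other is
  not. The only consecutive values so separated are \<open>m - 1\<close> and \<open>m\<close>, and
  values that are not consecutive never become so.\<close>

lemma shift_bond_iff:
  assumes "{x, y} \<noteq> {m, m - 1}"
  shows "shift m x = Suc (shift m y) \<or> shift m y = Suc (shift m x) \<longleftrightarrow> x = Suc y \<or> y = Suc x"
  using assms by (auto simp: shift_def split: if_splits)

section \<open>Bonds of a stretched list\<close>

text \<open>Bonds before \<open>i\<close> stay, those after \<open>i\<close> move one place to the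
  right, and \<open>i\<close> itself belongs to both parts because its bond splits in two.\<close>

lemma bonds_stretch:
  assumes "distinct \<sigma>" "i \<in> bonds \<sigma>"
  shows "bonds (stretch i \<sigma>) = {j \<in> bonds \<sigma>. j \<le> i} \<union> Suc ` {j \<in> bonds \<sigma>. i \<le> j}"
proof (rule set_eqI)
  fix j
  define m where "m = max (\<sigma> ! i) (\<sigma> ! Suc i)"
  have i: "Suc i < length \<sigma>" and bond: "\<sigma> ! i = Suc (\<sigma> ! Suc i) \<or> \<sigma> ! Suc i = Suc (\<sigma> ! i)"
    using assms(2) by (auto simp: bonds_def)
  have ends: "{m, m - 1} = {\<sigma> ! i, \<sigma> ! Suc i}"
    using bond by (auto simp: m_def)
  \<comment> \<open>By distinctness the values \<open>m\<close> and \<open>m - 1\<close> are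
    adjacent only at \<open>i\<close>, so \<open>shift_bond_iff\<close> applies at every other
    position.\<close>
  have other: "{\<sigma> ! k, \<sigma> ! Suc k} \<noteq> {m, m - 1}" if "Suc k < length \<sigma>" "k \<noteq> i" for k
  proof
    assume "{\<sigma> ! k, \<sigma> ! Suc k} = {m, m - 1}"
    then have "\<sigma> ! k = \<sigma> ! i \<and> \<sigma> ! Suc k = \<sigma> ! Suc i \<or> \<sigma> ! k = \<sigma> ! Suc i \<and> \<sigma> ! Suc k = \<sigma> ! i"
      unfolding ends doubleton_eq_iff .
    then show False
      using that i by (auto simp: nth_eq_iff_index_eq[OF assms(1)])
  qed
  have nth: "stretch i \<sigma> ! k =
      (if k \<le> i then shift m (\<sigma> ! k) else if k = Suc i then m else shift m (\<sigma> ! (k - 1)))"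
    if "k \<le> length \<sigma>" for k
    using nth_stretch[OF i that] by (simp add: m_def Let_def)
  consider "j < i" | "j = i" | "j = Suc i" | k where "j = Suc k" "i < k"
    by (metis Suc_lessE linorder_neqE_nat not_less_eq)
  then show "j \<in> bonds (stretch i \<sigma>) \<longleftrightarrow>
    j \<in> {j \<in> bonds \<sigma>. j \<le> i} \<union> Suc ` {j \<in> bonds \<sigma>. i \<le> j}"
  proof cases
    case 1
    then have "j \<in> bonds (stretch i \<sigma>) \<longleftrightarrow> j \<in> bonds \<sigma>"
      using i shift_bond_iff[OF other[of j]] by (simp add: bonds_def length_stretch nth)
    then show ?thesis
      using 1 by auto
  next
    case 2
    then have "j \<in> bonds (stretch i \<sigma>)"
      using i bond by (auto simp: bonds_def length_stretch nth shift_def m_def)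
    then show ?thesis
      using 2 assms(2) by auto
  next
    case 3
    then have "j \<in> bonds (stretch i \<sigma>)"
      using i bond by (auto simp: bonds_def length_stretch nth shift_def m_def)
    then show ?thesis
      using 3 assms(2) by auto
  next
    case 4
    then have "j \<in> bonds (stretch i \<sigma>) \<longleftrightarrow> k \<in> bonds \<sigma>"
      using shift_bond_iff[OF other[of k]] by (auto simp: bonds_def length_stretch nth)
    then show ?thesis
      using 4 by auto
  qed
qed

text \<open>A further bond \<open>j\<close> of \<open>\<sigma>\<close> would survive at
  \<open>j\<close> if \<open>j < i\<close>, or at \<open>Suc j\<close> if \<open>j > i\<close>, in
  either case outside \<open>{i, Suc i}\<close>.\<close>

lemma bonds_stretch_eq_iff:
  assumes "distinct \<sigma>" "i \<in> bonds \<sigma>"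
  shows "bonds (stretch i \<sigma>) = {i, Suc i} \<longleftrightarrow> bonds \<sigma> = {i}"
proof
  assume eq: "bonds (stretch i \<sigma>) = {i, Suc i}"
  have "j = i" if "j \<in> bonds \<sigma>" for j
  proof (cases "j \<le> i")
    case True
    then have "j \<in> {i, Suc i}"
      using bonds_stretch[OF assms] eq that by blast
    then show ?thesis
      using True by auto
  next
    case False
    then have "Suc j \<in> {i, Suc i}"
      using bonds_stretch[OF assms] eq that by auto
    then show ?thesis
      using False by auto
  qed
  then show "bonds \<sigma> = {i}"
    using assms(2) by blast
next
  assume "bonds \<sigma> = {i}"
  then show "bonds (stretch i \<sigma>) = {i, Suc i}"
    using bonds_stretch[OF assms] by auto
qed

section \<open>Stretching as a bijection between the two classes\<close>

text \<open>On the level of entry sets, the common new value \<open>m\<close> can be cancelled, and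
  then the injective \<open>shift m\<close>.\<close>

lemma permutation_stretch_iff:
  assumes "i \<in> bonds \<sigma>" "1 \<le> max (\<sigma> ! i) (\<sigma> ! Suc i)" "max (\<sigma> ! i) (\<sigma> ! Suc i) \<le> Suc N"
  shows "stretch i \<sigma> \<in> permutations_of_set {1..Suc N} \<longleftrightarrow> \<sigma> \<in> permutations_of_set {1..N}"
proof -
  define m where "m = max (\<sigma> ! i) (\<sigma> ! Suc i)"
  have "set (stretch i \<sigma>) = {1..Suc N} \<longleftrightarrow>
      insert m (shift m ` set \<sigma>) = insert m (shift m ` {1..N})"
    using shift_image_interval[of m N] assms by (simp add: set_stretch m_def)
  also have "\<dots> \<longleftrightarrow> shift m ` set \<sigma> = shift m ` {1..N}"
    by (rule insert_ident) (auto simp: shift_neq[symmetric])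
  also have "\<dots> \<longleftrightarrow> set \<sigma> = {1..N}"
    by (rule inj_image_eq_iff[OF inj_shift])
  finally show ?thesis
    by (auto simp: permutations_of_set_def distinct_stretch_iff)
qed

text \<open>Used in both directions: left to right for surjectivity, right to left for
  well-definedness. The bounds on the maximum can be read off from either permutation.\<close>

lemma stretch_in_iff:
  assumes "i \<in> bonds \<sigma>" "1 \<le> max (\<sigma> ! i) (\<sigma> ! Suc i)" "max (\<sigma> ! i) (\<sigma> ! Suc i) \<le> Suc N"
  shows "stretch i \<sigma> \<in> permutations_of_set {1..Suc N} \<and> separable (stretch i \<sigma>) \<and>
      bonds (stretch i \<sigma>) = {i, Suc i} \<longleftrightarrow>
    \<sigma> \<in> permutations_of_set {1..N} \<and> separable \<sigma> \<and> bonds \<sigma> = {i}"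
  using permutation_stretch_iff[OF assms] separable_stretch_iff[OF _ assms(1)]
    bonds_stretch_eq_iff[OF _ assms(1)] permutations_of_setD(2) by metis

text \<open>The entry at \<open>Suc i\<close> of the stretched list reveals which value was
  inserted, so both lists were relabelled by the same injective map.\<close>

lemma stretch_inj:
  assumes "stretch i \<sigma> = stretch i \<tau>" "Suc i < length \<sigma>"
  shows "\<sigma> = \<tau>"
proof -
  have len: "length \<sigma> = length \<tau>"
    using assms(1) length_stretch by (metis nat.inject)
  have m: "max (\<sigma> ! i) (\<sigma> ! Suc i) = max (\<tau> ! i) (\<tau> ! Suc i)"
    using nth_stretch[of i \<sigma> "Suc i"] nth_stretch[of i \<tau> "Suc i"] assms len by (simp add: Let_def)
  have "map (shift (max (\<tau> ! i) (\<tau> ! Suc i))) (take (Suc i) \<sigma>) =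
      map (shift (max (\<tau> ! i) (\<tau> ! Suc i))) (take (Suc i) \<tau>) \<and>
    map (shift (max (\<tau> ! i) (\<tau> ! Suc i))) (drop (Suc i) \<sigma>) =
      map (shift (max (\<tau> ! i) (\<tau> ! Suc i))) (drop (Suc i) \<tau>)"
    using assms(1) len by (simp add: stretch_def m Let_def)
  then have "take (Suc i) \<sigma> = take (Suc i) \<tau> \<and> drop (Suc i) \<sigma> = drop (Suc i) \<tau>"
    using inj_map_eq_map[OF inj_shift] by blast
  then show ?thesis
    by (metis append_take_drop_id)
qed

text \<open>The preimage arises by deleting the middle entry \<open>m\<close> of the run and closing
  the gap in the values. The last conclusion supplies the bounds that \<open>stretch_in_iff\<close>
  asks for.\<close>

lemma stretch_surj:
  assumes "distinct \<tau>" "i \<in> bonds \<tau>" "Suc i \<in> bonds \<tau>"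
  obtains \<sigma> where "\<tau> = stretch i \<sigma>" "i \<in> bonds \<sigma>" "max (\<sigma> ! i) (\<sigma> ! Suc i) \<in> set \<tau>"
proof -
  from assms(2) obtain A u m B' where \<tau>': "\<tau> = A @ u # m # B'" "i = length A" "u = Suc m \<or> m = Suc u"
    by (rule bondE)
  have "B' \<noteq> []"
    using assms(3) \<tau>' by (auto simp: bonds_def)
  then obtain v B where B': "B' = v # B"
    by (cases B') auto
  have \<tau>: "\<tau> = A @ u # m # v # B"
    using \<tau>' B' by simp
  have "m = Suc v \<or> v = Suc m"
    using assms(3) \<tau>'(2) by (auto simp: bonds_def \<tau> nth_append)
  moreover have "u \<noteq> v"
    using assms(1) \<tau> by auto
  \<comment> \<open>Two overlapping bonds in opposite directions would give
    \<open>u = v\<close>.\<close>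
  ultimately have runs: "u = Suc m \<and> m = Suc v \<or> v = Suc m \<and> m = Suc u"
    using \<tau>'(3) by auto
  \<comment> \<open>\<open>g\<close> inverts \<open>shift m\<close> on all values other than
    \<open>m\<close>.\<close>
  define g where "g = (\<lambda>x. if m < x then x - 1 else x)"
  \<comment> \<open>Of \<open>m - 1\<close> and \<open>m + 1\<close>, the map \<open>g\<close> fixes
    the first and sends the second to \<open>m\<close>, so \<open>stretch\<close> inserts
    \<open>m\<close> again.\<close>
  have max: "max (g u) (g v) = m"
    using runs by (auto simp: g_def)
  have sg: "shift m (g x) = x" if "x \<noteq> m" for x
    using that by (auto simp: g_def shift_def)
  have "map (shift m) (map g A) = A" "map (shift m) (map g B) = B"
    using assms(1) \<tau> by (auto intro!: map_idI sg)
  moreover have "shift m (g u) = u" "shift m (g v) = v"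
    using runs by (auto intro!: sg)
  ultimately have "\<tau> = stretch i (map g A @ g u # g v # map g B)"
    using stretch_append[of "map g A" "g u" "g v" "map g B"] \<tau>'(2) \<tau> max by simp
  moreover have "i \<in> bonds (map g A @ g u # g v # map g B)"
    using runs \<tau>'(2) by (auto simp: bonds_def nth_append g_def)
  moreover have "max ((map g A @ g u # g v # map g B) ! i) ((map g A @ g u # g v # map g B) ! Suc i) \<in> set \<tau>"
    using \<tau> \<tau>'(2) max by (simp add: nth_append)
  ultimately show thesis
    by (rule that)
qed

lemma separable_with_one_box_2:
  "\<sigma> \<in> separable_with_one_box n 2 \<longleftrightarrow>
    \<sigma> \<in> permutations_of_set {1..n} \<and> separable \<sigma> \<and> (\<exists>i. bonds \<sigma> = {i})"
  by (simp add: separable_with_one_box_def one_box_occurrences_eq card_Un_Suc_eq_2_iff finite_bonds)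

lemma separable_with_one_box_3:
  "\<sigma> \<in> separable_with_one_box n 3 \<longleftrightarrow>
    \<sigma> \<in> permutations_of_set {1..n} \<and> separable \<sigma> \<and> (\<exists>i. bonds \<sigma> = {i, Suc i})"
  by (simp add: separable_with_one_box_def one_box_occurrences_eq card_Un_Suc_eq_3_iff finite_bonds)

theorem theorem10:
  fixes n :: nat
  assumes "n \<ge> 1"
  shows "card (separable_with_one_box n 3) = card (separable_with_one_box (n - 1) 2)"
proof -
  obtain N where n: "n = Suc N"
    using assms by (cases n) auto
  \<comment> \<open>On the domain there is exactly one bond, so \<open>Min\<close> merely extracts
    its position.\<close>
  define \<Phi> where "\<Phi> \<sigma> = stretch (Min (bonds \<sigma>)) \<sigma>" for \<sigma>
  have \<Phi>: "\<Phi> \<sigma> = stretch i \<sigma>" if "bonds \<sigma> = {i}" for \<sigma> i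
    using that by (simp add: \<Phi>_def)
  have image: "stretch i \<sigma> \<in> permutations_of_set {1..Suc N} \<and> separable (stretch i \<sigma>) \<and>
      bonds (stretch i \<sigma>) = {i, Suc i}"
    if "\<sigma> \<in> separable_with_one_box N 2" "bonds \<sigma> = {i}" for \<sigma> i
  proof -
    have \<sigma>: "\<sigma> \<in> permutations_of_set {1..N}" "separable \<sigma>"
      using that(1) by (auto simp: separable_with_one_box_2)
    have len: "Suc i < length \<sigma>"
      using that(2) by (auto simp: bonds_def)
    have "\<sigma> ! i \<in> {1..N}" "\<sigma> ! Suc i \<in> {1..N}"
      using permutations_of_setD(1)[OF \<sigma>(1)] nth_mem[of i \<sigma>] nth_mem[of "Suc i" \<sigma>] len
      by simp_all
    then show ?thesis
      using stretch_in_iff[of i \<sigma> N] \<sigma> that(2) by (simp add: le_max_iff_disj)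
  qed
  have "bij_betw \<Phi> (separable_with_one_box N 2) (separable_with_one_box (Suc N) 3)"
    unfolding bij_betw_def
  proof (intro conjI inj_onI subset_antisym subsetI)
    fix \<sigma> \<tau>
    assume in2: "\<sigma> \<in> separable_with_one_box N 2" "\<tau> \<in> separable_with_one_box N 2"
      and eq: "\<Phi> \<sigma> = \<Phi> \<tau>"
    obtain i j where ij: "bonds \<sigma> = {i}" "bonds \<tau> = {j}"
      using in2 by (auto simp: separable_with_one_box_2)
    \<comment> \<open>The bonds of the common image determine where it was stretched.\<close>
    have "{i, Suc i} = {j, Suc j}"
      using image[OF in2(1) ij(1)] image[OF in2(2) ij(2)] eq \<Phi> ij by metis
    then have "i = j"
      by (auto simp: doubleton_eq_iff)
    then have "stretch i \<sigma> = stretch i \<tau>"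
      using eq \<Phi> ij by simp
    moreover have "Suc i < length \<sigma>"
      using ij by (auto simp: bonds_def)
    ultimately show "\<sigma> = \<tau>"
      by (rule stretch_inj)
  next
    fix \<tau>
    assume "\<tau> \<in> \<Phi> ` separable_with_one_box N 2"
    then obtain \<sigma> i where \<sigma>: "\<sigma> \<in> separable_with_one_box N 2" "bonds \<sigma> = {i}" "\<tau> = \<Phi> \<sigma>"
      by (auto simp: separable_with_one_box_2)
    show "\<tau> \<in> separable_with_one_box (Suc N) 3"
      using image[OF \<sigma>(1,2)] \<Phi>[OF \<sigma>(2)] \<sigma>(3) unfolding separable_with_one_box_3 by auto
  next
    fix \<tau>
    assume "\<tau> \<in> separable_with_one_box (Suc N) 3"
    then obtain i where \<tau>: "\<tau> \<in> permutations_of_set {1..Suc N}" "separable \<tau>" "bonds \<tau> = {i, Suc i}"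
      by (auto simp: separable_with_one_box_3)
    obtain \<sigma> where \<sigma>: "\<tau> = stretch i \<sigma>" "i \<in> bonds \<sigma>" "max (\<sigma> ! i) (\<sigma> ! Suc i) \<in> set \<tau>"
      using stretch_surj[of \<tau> i] permutations_of_setD(2)[OF \<tau>(1)] \<tau>(3) by auto
    \<comment> \<open>At this point nothing is known about the entries of \<open>\<sigma>\<close>;
      the bounds come from \<open>\<tau>\<close>.\<close>
    have "max (\<sigma> ! i) (\<sigma> ! Suc i) \<in> {1..Suc N}"
      using \<sigma>(3) permutations_of_setD(1)[OF \<tau>(1)] by simp
    then have "\<sigma> \<in> permutations_of_set {1..N} \<and> separable \<sigma> \<and> bonds \<sigma> = {i}"
      using stretch_in_iff[OF \<sigma>(2), of N] \<tau> \<sigma>(1) by auto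
    then have "\<sigma> \<in> separable_with_one_box N 2" "\<tau> = \<Phi> \<sigma>"
      using \<Phi> \<sigma>(1) by (auto simp: separable_with_one_box_2)
    then show "\<tau> \<in> \<Phi> ` separable_with_one_box N 2"
      by blast
  qed
  then show ?thesis
    using bij_betw_same_card n by fastforce
qed

end
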